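(* (i) Suppose that $\kappa = \nu^+$, $\sigma$ is an uncountable cardinal less than $\nu$, $J$ is a $\kappa$-complete ideal on $\kappa$ such that $E^\kappa_{>\sigma} \in J^*$ and $\curlywedge^-(\sigma, \kappa, J)$ holds, and $\tau$ is a regular cardinal less than $Depth({}^\kappa\kappa)$. Then there exists either an ascending $(J, I_\kappa)$-tower of length $\tau$, or a descending $(J, J)$-tower of length $\tau$. (ii) Suppose that $\kappa$ is weakly inaccessible, $\sigma$ is an uncountable cardinal less than $\kappa$, $J$ is a normal ideal on $\kappa$ such that $E^\kappa_{>\sigma} \in J^*$ and $\curlywedge^-(\sigma, \kappa, J)$ holds, and $\tau$ is a regular cardinal less than $Depth({}^\kappa\kappa)$. Then there exists either an ascending $(J, I_\kappa)$-tower of length $\tau$, or a descending $(J, J)$-tower of length $\tau$.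
   Context: $\kappa$ is a regular uncountable cardinal. An ideal on $\kappa$ is a nonempty $J \subseteq P(\kappa)$ with $\kappa \notin J$, every bounded subset of $\kappa$ in $J$, $J$ closed under subsets and under unions of two members; $J^+ = P(\kappa)\setminus J$, $J^* = \{A \subseteq \kappa : \kappa \setminus A \in J\}$; $\kappa$-complete means closed under unions of fewer than $\kappa$ members; normal is in the usual sense (closed under diagonal unions, and $\kappa$-complete). $I_\kappa$ is the ideal of bounded subsets of $\kappa$. $acc(\kappa)$ is the set of nonzero limit ordinals below $\kappa$, and $E^\kappa_{>\sigma} = \{\alpha \in acc(\kappa) : \mathrm{cf}(\alpha) > \sigma\}$. $P_\sigma(X) = \{x \subseteq X : |x| < \sigma\}$. For an infinite cardinal $\sigma$ and a limit ordinal $\delta \geq \sigma$, a subset $C$ of $P_\sigma(\delta)$ is a generalized club if there is $F : P_\omega(\delta) \to \delta$ with $\{x \in P_\sigma(\delta) : F``P_\omega(x) \subseteq x\} \subseteq C$. For an infinite cardinal $\sigma < \kappa$, $\curlywedge^-(\sigma,\kappa,J)$ asserts the existence, for each $\delta \in acc(\kappa)\setminus\sigma$ and $i < \delta$, of a cofinal subset $C^i_\delta$ of $(P_\sigma(\delta), \subseteq)$ such that $\{\delta : \exists i < \delta\, (C^i_\delta \subseteq D)\} \in J^+$ for every generalized club $D \subseteq P_\sigma(\kappa)$. For $f, g \in {}^\kappa\kappa$, $f <^* g$ means $|\{\alpha : f(\alpha) \geq g(\alpha)\}| < \kappa$; $Depth({}^\kappa\kappa)$ is the least ordinal $\eta$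 with no $<^*$-increasing sequence of length $\eta$ in ${}^\kappa\kappa$. For $Y \subseteq P(\kappa)$, a descending (respectively, ascending) $(J,Y)$-tower of length $\delta$ is $\langle A_\alpha : \alpha < \delta\rangle$ with each $A_\alpha \in J^+$ such that for $\alpha < \beta < \delta$: $A_\beta \setminus A_\alpha \in Y$ and $A_\alpha \setminus A_\beta \in J^+$ (respectively, $A_\alpha \setminus A_\beta \in Y$ and $A_\beta \setminus A_\alpha \in J^+$). *)

theory Defs
  imports Main
begin

text \<open>Ordinals below kappa are modelled by the elements of a well-ordered type 'k;
  kappa itself is the order type of UNIV :: 'k set.  The ordinal alpha is identified
  with its set of predecessors {..<alpha}.  Cardinalities are compared with the
  library notions card_of and ordLess2/ordLeq2/ordIso2.\<close>

definition card_lt :: "'a set \<Rightarrow> 'b set \<Rightarrow> bool" where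
  "card_lt A B \<longleftrightarrow> (card_of A, card_of B) \<in> ordLess"
definition card_le :: "'a set \<Rightarrow> 'b set \<Rightarrow> bool" where
  "card_le A B \<longleftrightarrow> (card_of A, card_of B) \<in> ordLeq"
definition card_eq :: "'a set \<Rightarrow> 'b set \<Rightarrow> bool" where
  "card_eq A B \<longleftrightarrow> (card_of A, card_of B) \<in> ordIso"

definition is_cardinal_elem :: "'k::wellorder \<Rightarrow> bool" where
  "is_cardinal_elem s \<longleftrightarrow> (\<forall>b<s. card_lt {..<b} {..<s})"

definition kappa_is_cardinal :: "'k::wellorder itself \<Rightarrow> bool" where
  "kappa_is_cardinal _ \<longleftrightarrow> (\<forall>b::'k. card_lt {..<b} (UNIV::'k set))"

definition uncountable_set :: "'a set \<Rightarrow> bool" where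
  "uncountable_set X \<longleftrightarrow> card_lt (UNIV::nat set) X"

definition regular_type :: "'t::wellorder itself \<Rightarrow> bool" where
  "regular_type _ \<longleftrightarrow>
     (\<forall>X::'t set. (\<forall>a. \<exists>x\<in>X. a \<le> x) \<longrightarrow> card_eq X (UNIV::'t set))"

definition regular_uncountable_cardinal_type :: "'t::wellorder itself \<Rightarrow> bool" where
  "regular_uncountable_cardinal_type T \<longleftrightarrow>
     (\<forall>b::'t. card_lt {..<b} (UNIV::'t set)) \<and> regular_type T
     \<and> uncountable_set (UNIV::'t set)"

definition regular_infinite_cardinal_type :: "'t::wellorder itself \<Rightarrow> bool" where
  "regular_infinite_cardinal_type T \<longleftrightarrow>
     (\<forall>b::'t. card_lt {..<b} (UNIV::'t set)) \<and> regular_type T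
     \<and> infinite (UNIV::'t set)"

text \<open>kappa = nu^+ : nu is an infinite cardinal below kappa and every ordinal below
  kappa has cardinality at most |nu| (kappa itself being a cardinal).\<close>
definition kappa_successor_of :: "'k::wellorder \<Rightarrow> bool" where
  "kappa_successor_of nu \<longleftrightarrow> is_cardinal_elem nu \<and> infinite {..<nu}
     \<and> (\<forall>b::'k. card_le {..<b} {..<nu})"

definition weakly_inaccessible :: "'k::wellorder itself \<Rightarrow> bool" where
  "weakly_inaccessible K \<longleftrightarrow> regular_uncountable_cardinal_type K
     \<and> (\<forall>b::'k. \<exists>c::'k. card_lt {..<b} {..<c})"

definition acc :: "'k::wellorder set" where
  "acc = {a. (\<exists>b. b < a) \<and> (\<forall>b<a. \<exists>c. b < c \<and> c < a)}"

definition cf_gt :: "'k::wellorder \<Rightarrow> 'k \<Rightarrow> bool" where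
  "cf_gt a s \<longleftrightarrow> (\<forall>X. X \<subseteq> {..<a} \<and> (\<forall>b<a. \<exists>x\<in>X. b \<le> x)
                     \<longrightarrow> card_lt {..<s} X)"

definition E_gt :: "'k::wellorder \<Rightarrow> 'k set" where
  "E_gt s = {a \<in> acc. cf_gt a s}"

definition I_kappa :: "'k::wellorder set set" where
  "I_kappa = {A. \<exists>b. A \<subseteq> {..<b}}"

definition is_ideal :: "'k::wellorder set set \<Rightarrow> bool" where
  "is_ideal J \<longleftrightarrow> J \<noteq> {} \<and> UNIV \<notin> J \<and> I_kappa \<subseteq> J
     \<and> (\<forall>A B. A \<in> J \<and> B \<subseteq> A \<longrightarrow> B \<in> J)
     \<and> (\<forall>A B. A \<in> J \<and> B \<in> J \<longrightarrow> A \<union> B \<in> J)"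

definition J_plus :: "'k::wellorder set set \<Rightarrow> 'k set set" where
  "J_plus J = - J"

definition J_star :: "'k::wellorder set set \<Rightarrow> 'k set set" where
  "J_star J = {A. - A \<in> J}"

definition kappa_complete :: "'k::wellorder set set \<Rightarrow> bool" where
  "kappa_complete J \<longleftrightarrow> is_ideal J \<and>
     (\<forall>F. F \<subseteq> J \<and> card_lt F (UNIV::'k set) \<longrightarrow> \<Union>F \<in> J)"

definition diag_union :: "('k::wellorder \<Rightarrow> 'k set) \<Rightarrow> 'k set" where
  "diag_union A = {b. \<exists>a<b. b \<in> A a}"

definition normal_ideal :: "'k::wellorder set set \<Rightarrow> bool" where
  "normal_ideal J \<longleftrightarrow> kappa_complete J \<and>
     (\<forall>A. (\<forall>a. A a \<in> J) \<longrightarrow> diag_union A \<in> J)"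

definition P_lt :: "'k::wellorder \<Rightarrow> 'k set \<Rightarrow> 'k set set" where
  "P_lt s X = {x. x \<subseteq> X \<and> card_lt x {..<s}}"

definition gen_club :: "'k::wellorder \<Rightarrow> 'k set \<Rightarrow> 'k set set \<Rightarrow> bool" where
  "gen_club s X C \<longleftrightarrow> (\<exists>F::'k set \<Rightarrow> 'k.
      (\<forall>y. finite y \<and> y \<subseteq> X \<longrightarrow> F y \<in> X) \<and>
      {x \<in> P_lt s X. (\<forall>y. finite y \<and> y \<subseteq> x \<longrightarrow> F y \<in> x)} \<subseteq> C)"

definition cofinal_in :: "'k set set \<Rightarrow> 'k set set \<Rightarrow> bool" where
  "cofinal_in C P \<longleftrightarrow> C \<subseteq> P \<and> (\<forall>x\<in>P. \<exists>y\<in>C. x \<subseteq> y)"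

definition curlywedge_minus :: "'k::wellorder \<Rightarrow> 'k set set \<Rightarrow> bool" where
  "curlywedge_minus s J \<longleftrightarrow> (\<exists>C :: 'k \<Rightarrow> 'k \<Rightarrow> 'k set set.
      (\<forall>d \<in> acc. s \<le> d \<longrightarrow> (\<forall>i<d. cofinal_in (C d i) (P_lt s {..<d}))) \<and>
      (\<forall>D. D \<subseteq> P_lt s UNIV \<and> gen_club s UNIV D \<longrightarrow>
           {d \<in> acc. s \<le> d \<and> (\<exists>i<d. C d i \<subseteq> D)} \<in> J_plus J))"

definition less_star :: "('k::wellorder \<Rightarrow> 'k) \<Rightarrow> ('k \<Rightarrow> 'k) \<Rightarrow> bool" where
  "less_star f g \<longleftrightarrow> card_lt {a. g a \<le> f a} (UNIV::'k set)"

text \<open>tau < Depth(kappa^kappa), where tau is the order type of 't: for every ordinal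
  eta \<le> tau (i.e. eta = tau or eta = an initial segment {..<t}) there is a
  <*-increasing sequence of length eta.\<close>
definition below_depth :: "'t::wellorder itself \<Rightarrow> 'k::wellorder itself \<Rightarrow> bool" where
  "below_depth _ _ \<longleftrightarrow> (\<forall>X::'t set. (X = UNIV \<or> (\<exists>t. X = {..<t})) \<longrightarrow>
      (\<exists>f::'t \<Rightarrow> 'k \<Rightarrow> 'k. \<forall>a\<in>X. \<forall>b\<in>X. a < b \<longrightarrow> less_star (f a) (f b)))"

definition descending_tower :: "'k::wellorder set set \<Rightarrow> 'k set set \<Rightarrow> ('t::wellorder \<Rightarrow> 'k set) \<Rightarrow> bool" where
  "descending_tower J Y A \<longleftrightarrow> (\<forall>a. A a \<in> J_plus J) \<and>
     (\<forall>a b. a < b \<longrightarrow> A b - A a \<in> Y \<and> A a - A b \<in> J_plus J)"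

definition ascending_tower :: "'k::wellorder set set \<Rightarrow> 'k set set \<Rightarrow> ('t::wellorder \<Rightarrow> 'k set) \<Rightarrow> bool" where
  "ascending_tower J Y A \<longleftrightarrow> (\<forall>a. A a \<in> J_plus J) \<and>
     (\<forall>a b. a < b \<longrightarrow> A a - A b \<in> Y \<and> A b - A a \<in> J_plus J)"

end

theory Submission
  imports Defs
begin

text \<open>Fix a \<open><\<^sup>*\<close>-increasing sequence \<open>f\<close> of length \<open>\<tau>\<close>. If \<open>\<tau>\<close> exceeds the number of indices
  \<open>i\<close>, one index \<open>i\<close> guesses, for cofinally many \<open>a\<close>, the sets closed under \<open>f a\<close>. Pick
  \<open>x \<delta> \<xi> \<in> C\<^sup>i\<^sub>\<delta>\<close> containing \<open>\<xi>\<close> and let \<open>T a b\<close> be the set of those \<open>\<delta>\<close> such that, for all large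
  \<open>\<xi> < \<delta>\<close>, the set \<open>x \<delta> \<xi>\<close> meets the interval \<open>[f a \<xi>, f b \<xi>)\<close>. It is positive, and modulo bounded
  sets it grows with \<open>b\<close> and shrinks with \<open>a\<close>. If for some \<open>a\<close> the sets \<open>T a b\<close> do not stabilise
  modulo \<open>J\<close>, they yield an ascending tower. Otherwise their eventual values \<open>S a\<close> descend modulo
  \<open>J\<close>. If the \<open>S a\<close> stabilise, then some \<open>\<delta>\<close> of cofinality greater than \<open>\<sigma>\<close> lies in \<open>\<sigma>\<close> many of them,
  so one \<open>x \<delta> \<xi>\<close> meets \<open>\<sigma>\<close> many disjoint intervals, although it has fewer than \<open>\<sigma>\<close> elements.
  If \<open>\<tau>\<close> is at most the number of indices, \<open>\<kappa>\<close> many disjoint positive sets suffice; they come from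
  an Ulam matrix or from a regressive function that is not bounded modulo \<open>J\<close>.\<close>

section \<open>Cardinal comparison and regular well-orders\<close>

lemma card_lt_image: "card_lt A B \<Longrightarrow> card_lt (f ` A) B"
  unfolding card_lt_def using card_of_image ordLeq_ordLess_trans by blast

lemma card_lt_subset: "card_lt A B \<Longrightarrow> A' \<subseteq> A \<Longrightarrow> card_lt A' B"
  unfolding card_lt_def using card_of_mono1 ordLeq_ordLess_trans by blast

lemma card_le_lt_trans: "card_le A B \<Longrightarrow> card_lt B C \<Longrightarrow> card_lt A C"
  unfolding card_lt_def card_le_def using ordLeq_ordLess_trans by blast

lemma card_lt_not_le: "card_lt A B \<Longrightarrow> \<not> card_le B A"
  unfolding card_lt_def card_le_def using not_ordLess_ordLeq by blast

lemma card_lt_or_le: "card_lt A B \<or> card_le B A"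
  unfolding card_lt_def card_le_def by (rule ordLess_or_ordLeq[OF card_of_Well_order card_of_Well_order])

lemma card_lt_imp_le: "card_lt A B \<Longrightarrow> card_le A B"
  unfolding card_lt_def card_le_def by (rule ordLess_imp_ordLeq)

lemma card_le_inj: "card_le A B \<longleftrightarrow> (\<exists>f. inj_on f A \<and> f ` A \<subseteq> B)"
  unfolding card_le_def by (simp add: card_of_ordLeq)

lemma small_bounded:
  fixes X :: "'t::wellorder set"
  assumes "regular_type TYPE('t)" and "card_lt X (UNIV::'t set)"
  shows "\<exists>a. \<forall>x\<in>X. x < a"
proof (rule ccontr)
  assume "\<not> ?thesis"
  then have "\<forall>a. \<exists>x\<in>X. a \<le> x" by (meson not_le)
  then have "card_eq X (UNIV::'t set)" using assms(1) unfolding regular_type_def by blast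
  then show False
    using not_ordLess_ordIso[of "card_of X" "card_of (UNIV::'t set)"] assms(2)
    unfolding card_lt_def card_eq_def by simp
qed

lemma small_family_bound:
  fixes h :: "'a \<Rightarrow> 't::wellorder"
  assumes "regular_type TYPE('t)" and "card_lt I (UNIV::'t set)"
  shows "\<exists>a. \<forall>i\<in>I. h i < a"
  using small_bounded[OF assms(1) card_lt_image[OF assms(2), of h]] by blast

text \<open>If every fibre were bounded, the bounds \<open>u i\<close> would form a small family
  with a common strict bound \<open>a\<close>, leaving no value for \<open>h a\<close>.\<close>

lemma regular_pigeonhole:
  fixes h :: "'t::wellorder \<Rightarrow> 'a"
  assumes reg: "regular_type TYPE('t)" and I: "card_lt I (UNIV::'t set)" and h: "\<And>a. h a \<in> I"
  shows "\<exists>i\<in>I. \<forall>a. \<exists>b\<ge>a. h b = i"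
proof (rule ccontr)
  assume "\<not> ?thesis"
  then obtain u where u: "\<And>i b. i \<in> I \<Longrightarrow> u i \<le> b \<Longrightarrow> h b \<noteq> i" by metis
  obtain a where "\<forall>i\<in>I. u i < a" using small_family_bound[OF reg I] by blast
  then show False using u[OF h[of a]] h[of a] less_imp_le by blast
qed

text \<open>Serves to thin out indices: by transfinite recursion \<open>c b\<close> is chosen past
  \<open>g\<close> of all earlier terms, which are too few to be unbounded.\<close>

lemma regular_sequence:
  fixes g :: "'t::wellorder \<Rightarrow> 't"
  assumes T: "regular_infinite_cardinal_type TYPE('t)"
  shows "\<exists>c :: 't \<Rightarrow> 't. (\<forall>a. u \<le> c a) \<and> (\<forall>a b. a < b \<longrightarrow> g (c a) \<le> c b)"
proof -
  define R where "R c b v \<longleftrightarrow> u \<le> v \<and> (\<forall>a<b. g (c a) \<le> v)" for c :: "'t \<Rightarrow> 't" and b v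
  have R: "\<exists>v. R c b v" for c b
  proof -
    have "card_lt {..<b} (UNIV::'t set)" and reg: "regular_type TYPE('t)"
      using T unfolding regular_infinite_cardinal_type_def by auto
    from small_family_bound[OF reg this(1), of "\<lambda>a. g (c a)"]
    obtain v where "\<forall>a\<in>{..<b}. g (c a) < v" by blast
    then have "R c b (max u v)" unfolding R_def by (auto intro: less_imp_le simp: le_max_iff_disj)
    then show ?thesis by blast
  qed
  define c where "c = wfrec {(a, b::'t). a < b} (\<lambda>c b. SOME v. R c b v)"
  have wf: "wf {(a, b::'t). a < b}" by (rule wf)
  have "R c b (c b)" for b
  proof -
    have "c b = (SOME v. R (cut c {(a, b::'t). a < b} b) b v)"
      unfolding c_def by (subst wfrec[OF wf]) simp
    \<comment> \<open>\<open>R c b\<close> consults \<open>c\<close> only below \<open>b\<close>, so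
      cutting \<open>c\<close> off there changes nothing.\<close>
    moreover have "R (cut c {(a, b::'t). a < b} b) b = R c b"
      by (auto simp: R_def cut_def fun_eq_iff)
    ultimately show ?thesis using someI_ex[OF R[of c b]] by simp
  qed
  then show ?thesis unfolding R_def by blast
qed

section \<open>Ideals and positive sets\<close>

lemma ideal_subset: "is_ideal J \<Longrightarrow> A \<in> J \<Longrightarrow> B \<subseteq> A \<Longrightarrow> B \<in> J"
  unfolding is_ideal_def by blast

lemma ideal_Un: "is_ideal J \<Longrightarrow> A \<in> J \<Longrightarrow> B \<in> J \<Longrightarrow> A \<union> B \<in> J"
  unfolding is_ideal_def by blast

lemma ideal_bounded: "is_ideal J \<Longrightarrow> A \<in> I_kappa \<Longrightarrow> A \<in> J"
  unfolding is_ideal_def by blast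

lemma pos_superset: "is_ideal J \<Longrightarrow> A \<in> J_plus J \<Longrightarrow> A \<subseteq> B \<Longrightarrow> B \<in> J_plus J"
  unfolding J_plus_def using ideal_subset[of J B A] by auto

lemma pos_Diff: "is_ideal J \<Longrightarrow> A \<in> J_plus J \<Longrightarrow> B \<in> J \<Longrightarrow> A - B \<in> J_plus J"
  unfolding J_plus_def using ideal_Un[of J "A - B" B] ideal_subset[of J "(A - B) \<union> B" A] by auto

lemma complete_UN:
  fixes J :: "'k::wellorder set set"
  assumes "kappa_complete J" and "card_lt I (UNIV::'k set)" and "\<And>i. i \<in> I \<Longrightarrow> B i \<in> J"
  shows "(\<Union>i\<in>I. B i) \<in> J"
  using assms card_lt_image[OF assms(2), of B] unfolding kappa_complete_def by blast

section \<open>Towers from unstable and from disjoint families\<close>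

lemma ascending_tower_if_unstable:
  fixes B :: "'t::wellorder \<Rightarrow> 'k::wellorder set"
  assumes J: "is_ideal J" and T: "regular_infinite_cardinal_type TYPE('t)"
    and mono: "\<And>a b. a \<le> b \<Longrightarrow> B a - B b \<in> I_kappa"
    and ex: "\<And>a. \<exists>b>a. B b - B a \<in> J_plus J"
  shows "\<exists>A :: 't \<Rightarrow> 'k set. ascending_tower J I_kappa A"
proof -
  obtain g where g: "\<And>a. a < g a" "\<And>a. B (g a) - B a \<in> J_plus J" using ex by metis
  obtain c :: "'t \<Rightarrow> 't" where c: "\<And>a b. a < b \<Longrightarrow> g (c a) \<le> c b"
    using regular_sequence[OF T, of undefined g] by blast
  have pos: "B (g (c a)) \<in> J_plus J" for a
    by (rule pos_superset[OF J g(2)]) blast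
  have le: "g (c a) \<le> g (c b)" if "a < b" for a b
    using c[OF that] g(1)[of "c b"] by simp
  \<comment> \<open>The jump \<open>B (g (c b)) - B (c b)\<close> is positive, and
    \<open>B (g (c a))\<close> lies in \<open>B (c b)\<close> up to a bounded set because
    \<open>g (c a) \<le> c b\<close>.\<close>
  have "B (g (c b)) - B (g (c a)) \<in> J_plus J" if "a < b" for a b
    by (rule pos_superset[OF J pos_Diff[OF J g(2)[of "c b"] ideal_bounded[OF J mono[OF c[OF that]]]]])
       blast
  then have "ascending_tower J I_kappa (\<lambda>a. B (g (c a)))"
    unfolding ascending_tower_def using pos mono[OF le] by blast
  then show ?thesis by blast
qed

text \<open>Dual to the ascending case: the jump \<open>S (c a) - S (g (c a))\<close> makes
  \<open>S (c a)\<close> positive, and \<open>S (c b)\<close> lies in \<open>S (g (c a))\<close>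
  modulo \<open>J\<close>, so it misses almost all of the jump.\<close>

lemma descending_tower_if_unstable:
  fixes S :: "'t::wellorder \<Rightarrow> 'k::wellorder set"
  assumes J: "is_ideal J" and T: "regular_infinite_cardinal_type TYPE('t)"
    and anti: "\<And>a b. a \<le> b \<Longrightarrow> S b - S a \<in> J"
    and ex: "\<And>a. \<exists>b>a. S a - S b \<in> J_plus J"
  shows "\<exists>A :: 't \<Rightarrow> 'k set. descending_tower J J A"
proof -
  obtain g where g: "\<And>a. a < g a" "\<And>a. S a - S (g a) \<in> J_plus J" using ex by metis
  obtain c :: "'t \<Rightarrow> 't" where c: "\<And>a b. a < b \<Longrightarrow> g (c a) \<le> c b"
    using regular_sequence[OF T, of undefined g] by blast
  have pos: "S (c a) \<in> J_plus J" for a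
    by (rule pos_superset[OF J g(2)]) blast
  have le: "c a \<le> c b" if "a < b" for a b
    using c[OF that] g(1)[of "c a"] by simp
  have "S (c a) - S (c b) \<in> J_plus J" if "a < b" for a b
    by (rule pos_superset[OF J pos_Diff[OF J g(2)[of "c a"] anti[OF c[OF that]]]]) blast
  then have "descending_tower J J (\<lambda>a. S (c a))"
    unfolding descending_tower_def using pos anti[OF le] by blast
  then show ?thesis by blast
qed

text \<open>Cumulative unions along an injection of \<open>'t\<close> into \<open>W\<close> increase
  outright, and disjointness keeps \<open>P (e b)\<close> away from all earlier unions.\<close>

lemma ascending_tower_if_disjoint:
  fixes P :: "'a \<Rightarrow> 'k::wellorder set"
  assumes J: "is_ideal J" and le: "card_le (UNIV::'t::wellorder set) W"
    and pos: "\<And>w. w \<in> W \<Longrightarrow> P w \<in> J_plus J"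
    and disj: "\<And>v w. v \<in> W \<Longrightarrow> w \<in> W \<Longrightarrow> v \<noteq> w \<Longrightarrow> P v \<inter> P w = {}"
  shows "\<exists>A :: 't \<Rightarrow> 'k set. ascending_tower J I_kappa A"
proof -
  obtain e :: "'t \<Rightarrow> 'a" where e: "inj e" "range e \<subseteq> W" using le unfolding card_le_inj by blast
  define A where "A a = (\<Union>b\<in>{..a}. P (e b))" for a
  have "A a \<in> J_plus J" for a
    by (rule pos_superset[OF J pos[of "e a"]]) (use e in \<open>auto simp: A_def\<close>)
  moreover have "A a - A b \<in> I_kappa" if "a < b" for a b
  proof -
    have "A a - A b = {}" using that unfolding A_def by fastforce
    then show ?thesis unfolding I_kappa_def by auto
  qed
  moreover have "A b - A a \<in> J_plus J" if "a < b" for a b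
  proof (rule pos_superset[OF J pos[of "e b"]])
    have "P (e b) \<inter> P (e c) = {}" if "c \<le> a" for c
      by (rule disj) (use e that \<open>a < b\<close> in \<open>auto dest: injD\<close>)
    then show "P (e b) \<subseteq> A b - A a" unfolding A_def by auto
  qed (use e in auto)
  ultimately have "ascending_tower J I_kappa A" unfolding ascending_tower_def by blast
  then show ?thesis by blast
qed

section \<open>Interval-meeting sets and their stabilisation\<close>

lemma cf_gt_family_bound:
  assumes "cf_gt d s" and "card_le W {..<s}" and "\<And>w. w \<in> W \<Longrightarrow> h w < d"
  shows "\<exists>b<d. \<forall>w\<in>W. h w < b"
proof (rule ccontr)
  assume "\<not> ?thesis"
  then have "\<forall>b<d. \<exists>x\<in>h ` W. b \<le> x" by (meson image_eqI not_le)
  moreover have "h ` W \<subseteq> {..<d}" using assms(3) by auto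
  ultimately have "card_lt {..<s} (h ` W)" using assms(1) unfolding cf_gt_def by blast
  moreover have "card_le (h ` W) {..<s}"
    using assms(2) unfolding card_le_def using card_of_image ordLeq_transitive by blast
  ultimately show False using card_lt_not_le by blast
qed

lemma less_star_tail:
  fixes f g :: "'k::wellorder \<Rightarrow> 'k"
  assumes "regular_type TYPE('k)" and "less_star f g"
  shows "\<exists>u. \<forall>z\<ge>u. f z < g z"
  using small_bounded[OF assms(1), of "{a. g a \<le> f a}"] assms(2)
  unfolding less_star_def by (auto simp: not_le[symmetric])

text \<open>\<open>sep x (f a) (f b)\<close> is the set \<open>T a b\<close> from above.\<close>
definition sep :: "('k::wellorder \<Rightarrow> 'k \<Rightarrow> 'k set) \<Rightarrow> ('k \<Rightarrow> 'k) \<Rightarrow> ('k \<Rightarrow> 'k) \<Rightarrow> 'k set" where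
  "sep x f g = {d. \<exists>u<d. \<forall>z. u \<le> z \<and> z < d \<longrightarrow> (\<exists>w\<in>x d z. f z \<le> w \<and> w < g z)}"

text \<open>For \<open>d > u\<close> the threshold in \<open>sep\<close> can be raised to
  \<open>max u v\<close>, beyond which every interval only widens.\<close>

lemma sep_mono:
  assumes f: "\<forall>z\<ge>u. f' z \<le> f z" and g: "\<forall>z\<ge>u. g z \<le> g' z"
  shows "sep x f g - sep x f' g' \<subseteq> {..u}"
proof -
  have "d \<in> sep x f' g'" if d: "d \<in> sep x f g" "u < d" for d
  proof -
    obtain v where v: "v < d" "\<And>z. v \<le> z \<Longrightarrow> z < d \<Longrightarrow> \<exists>w\<in>x d z. f z \<le> w \<and> w < g z"
      using d unfolding sep_def by blast
    have "\<exists>w\<in>x d z. f' z \<le> w \<and> w < g' z" if z: "max u v \<le> z" "z < d" for z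
    proof -
      have "f' z \<le> f z" "g z \<le> g' z" "v \<le> z" using f g z(1) by auto
      then show ?thesis using v(2)[OF \<open>v \<le> z\<close> z(2)] by (meson order_trans less_le_trans)
    qed
    then show ?thesis unfolding sep_def using d(2) v(1) by (auto intro!: exI[of _ "max u v"])
  qed
  then show ?thesis by (auto simp: not_less[symmetric])
qed

lemma finite_card_lt: "infinite B \<Longrightarrow> finite A \<Longrightarrow> card_lt A B"
  unfolding card_lt_def by (rule finite_ordLess_infinite[OF card_of_Well_order card_of_Well_order]) (auto simp: Field_card_of)

lemma uncountable_set_infinite: "uncountable_set X \<Longrightarrow> infinite X"
proof
  assume "uncountable_set X" "finite X"
  then have "card_lt (UNIV::nat set) X" "card_lt X (UNIV::nat set)"
    unfolding uncountable_set_def by (auto intro: finite_card_lt)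
  then show False using card_lt_not_le card_lt_imp_le by blast
qed

lemma no_greatest:
  assumes "regular_infinite_cardinal_type TYPE('t::wellorder)"
  shows "\<exists>b::'t. a < b"
proof -
  have "card_lt {a} (UNIV::'t set)"
    using assms by (intro finite_card_lt) (auto simp: regular_infinite_cardinal_type_def)
  then show ?thesis
    using small_bounded[of "{a}"] assms unfolding regular_infinite_cardinal_type_def by blast
qed

lemma atMost_in_I_kappa:
  assumes "regular_uncountable_cardinal_type TYPE('k::wellorder)"
  shows "{..u::'k} \<in> I_kappa"
proof -
  have "regular_type TYPE('k)" and "infinite (UNIV::'k set)"
    using assms uncountable_set_infinite unfolding regular_uncountable_cardinal_type_def by auto
  then have "regular_type TYPE('k)" "card_lt {u} (UNIV::'k set)" by (auto intro: finite_card_lt)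
  from small_bounded[OF this] obtain a where "u < a" by blast
  then show ?thesis unfolding I_kappa_def by (auto intro!: exI[of _ a])
qed

lemma subset_atMost_in_I_kappa:
  assumes "regular_uncountable_cardinal_type TYPE('k::wellorder)" and "A \<subseteq> {..u::'k}"
  shows "A \<in> I_kappa"
  using atMost_in_I_kappa[OF assms(1), of u] assms(2) unfolding I_kappa_def by blast

text \<open>The sets \<open>x d z\<close> are too small to be met by \<open>|s|\<close> many disjoint intervals.\<close>
lemma no_stable_sep:
  fixes f g :: "'w::linorder \<Rightarrow> 'k::wellorder \<Rightarrow> 'k"
  assumes K: "regular_uncountable_cardinal_type TYPE('k)" and J: "kappa_complete J"
    and E: "E_gt s \<in> J_star J"
    and x: "\<And>d z. card_lt (x d z) {..<s}"
    and W: "card_eq W {..<s}"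
    and le: "\<And>a b. a \<in> W \<Longrightarrow> b \<in> W \<Longrightarrow> a < b \<Longrightarrow> \<exists>u. \<forall>z\<ge>u. g a z \<le> f b z"
    and S: "\<And>a. a \<in> W \<Longrightarrow> S - sep x (f a) (g a) \<in> J"
  shows "S \<in> J"
proof (rule ccontr)
  assume pos: "S \<notin> J"
  have reg: "regular_type TYPE('k)" and sK: "card_lt {..<s} (UNIV::'k set)"
    using K unfolding regular_uncountable_cardinal_type_def by auto
  have id: "is_ideal J" using J unfolding kappa_complete_def by blast
  have Ws: "card_le W {..<s}" "card_le {..<s} W"
    using W ordIso_iff_ordLeq unfolding card_eq_def card_le_def by blast+
  have WK: "card_lt W (UNIV::'k set)" by (rule card_le_lt_trans[OF Ws(1) sK])
  obtain u where u: "\<And>a b z. a \<in> W \<Longrightarrow> b \<in> W \<Longrightarrow> a < b \<Longrightarrow> u a b \<le> z \<Longrightarrow> g a z \<le> f b z"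
    using le by metis
  \<comment> \<open>Two uses of regularity give one \<open>B\<close> above the thresholds
    \<open>u a b\<close> of all pairs from \<open>W\<close>.\<close>
  have "\<forall>a. \<exists>v. \<forall>b\<in>W. u a b < v" using small_family_bound[OF reg WK] by blast
  then obtain v where v: "\<And>a b. b \<in> W \<Longrightarrow> u a b < v a" by metis
  obtain B where B: "\<And>a. a \<in> W \<Longrightarrow> v a < B" using small_family_bound[OF reg WK, of v] by blast
  \<comment> \<open>A point of \<open>S\<close> outside \<open>N\<close> lies in
    \<open>sep x (f a) (g a)\<close> for every \<open>a\<close> in \<open>W\<close>, has cofinality
    above \<open>s\<close> and exceeds \<open>B\<close>.\<close>
  define N where "N = (\<Union>a\<in>W. S - sep x (f a) (g a)) \<union> (- E_gt s) \<union> {..B}"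
  have "N \<in> J" unfolding N_def
    using complete_UN[OF J WK S] E ideal_bounded[OF id atMost_in_I_kappa[OF K]]
    by (auto intro!: ideal_Un[OF id] simp: J_star_def)
  then have "\<not> S \<subseteq> N" using pos ideal_subset[OF id] by blast
  then obtain d where d: "\<And>a. a \<in> W \<Longrightarrow> d \<in> sep x (f a) (g a)" "cf_gt d s" "B < d"
    unfolding N_def E_gt_def by fastforce
  have "\<forall>a\<in>W. \<exists>h<d. \<forall>z. h \<le> z \<and> z < d \<longrightarrow> (\<exists>w\<in>x d z. f a z \<le> w \<and> w < g a z)"
    using d(1) unfolding sep_def by blast
  then obtain h where h: "\<And>a. a \<in> W \<Longrightarrow> h a < d"
    "\<And>a z. a \<in> W \<Longrightarrow> h a \<le> z \<Longrightarrow> z < d \<Longrightarrow> \<exists>w\<in>x d z. f a z \<le> w \<and> w < g a z" by metis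
  \<comment> \<open>There are at most \<open>|s|\<close> thresholds \<open>h a\<close>, so the
    cofinality of \<open>d\<close> bounds them below \<open>d\<close> and a single \<open>z\<close>
    serves all of \<open>W\<close>.\<close>
  obtain b where b: "b < d" "\<And>a. a \<in> W \<Longrightarrow> h a < b"
    using cf_gt_family_bound[OF d(2) Ws(1), of h] h(1) by blast
  define z where "z = max b B"
  have "\<forall>a\<in>W. \<exists>w\<in>x d z. f a z \<le> w \<and> w < g a z"
    using h(2) b d(3) by (auto simp: z_def le_max_iff_disj less_imp_le)
  then obtain w where w: "\<And>a. a \<in> W \<Longrightarrow> w a \<in> x d z" "\<And>a. a \<in> W \<Longrightarrow> f a z \<le> w a"
    "\<And>a. a \<in> W \<Longrightarrow> w a < g a z" by metis
  \<comment> \<open>At \<open>z\<close> the intervals are in order: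
    \<open>w a < g a z \<le> f b z \<le> w b\<close>.\<close>
  have less: "w a < w b" if "a \<in> W" "b \<in> W" "a < b" for a b
  proof -
    have "u a b \<le> z" using v[OF that(2)] B[OF that(1)] unfolding z_def
      by (meson less_imp_le less_trans max.coboundedI2)
    then show ?thesis using u[OF that] w(3)[OF that(1)] w(2)[OF that(2)] by (meson less_le_trans)
  qed
  have "inj_on w W" by (rule linorder_inj_onI') (use less in force)
  then have "card_le W (x d z)" using w(1) unfolding card_le_inj by blast
  then have "card_le {..<s} (x d z)"
    using Ws(2) unfolding card_le_def using ordLeq_transitive by blast
  then show False using card_lt_not_le[OF x] by blast
qed

lemma tower_if_sep_positive:
  fixes f :: "'t::wellorder \<Rightarrow> 'k::wellorder \<Rightarrow> 'k"
  assumes K: "regular_uncountable_cardinal_type TYPE('k)" and J: "kappa_complete J"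
    and E: "E_gt s \<in> J_star J"
    and x: "\<And>d z. card_lt (x d z) {..<s}"
    and T: "regular_infinite_cardinal_type TYPE('t)" and sT: "card_lt {..<s} (UNIV::'t set)"
    and f: "\<And>a b. a < b \<Longrightarrow> \<exists>u. \<forall>z\<ge>u. f a z \<le> f b z"
    and pos: "\<And>a b. a < b \<Longrightarrow> sep x (f a) (f b) \<in> J_plus J"
  shows "(\<exists>A :: 't \<Rightarrow> 'k set. ascending_tower J I_kappa A)
       \<or> (\<exists>A :: 't \<Rightarrow> 'k set. descending_tower J J A)"
proof -
  have id: "is_ideal J" using J unfolding kappa_complete_def by blast
  define B where "B a b = sep x (f a) (f b)" for a b
  have f': "\<exists>u. \<forall>z\<ge>u. f a z \<le> f b z" if "a \<le> b" for a b
    using f[of a b] that by (cases "a = b") auto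
  have mono: "B a b - B a b' \<in> I_kappa" if bb: "b \<le> b'" for a b b'
  proof -
    obtain u where "\<forall>z\<ge>u. f b z \<le> f b' z" using f'[OF bb] by blast
    then have "B a b - B a b' \<subseteq> {..u}" unfolding B_def by (intro sep_mono) auto
    then show ?thesis by (rule subset_atMost_in_I_kappa[OF K])
  qed
  have anti: "B a' b - B a b \<in> I_kappa" if aa: "a \<le> a'" for a a' b
  proof -
    obtain u where "\<forall>z\<ge>u. f a z \<le> f a' z" using f'[OF aa] by blast
    then have "B a' b - B a b \<subseteq> {..u}" unfolding B_def by (intro sep_mono) auto
    then show ?thesis by (rule subset_atMost_in_I_kappa[OF K])
  qed
  show ?thesis
  proof (cases "\<exists>a. \<forall>b. \<exists>c>b. B a c - B a b \<in> J_plus J")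
    case True
    then obtain a where "\<And>b. \<exists>c>b. B a c - B a b \<in> J_plus J" by blast
    from ascending_tower_if_unstable[OF id T mono this] show ?thesis by blast
  next
    case False
    \<comment> \<open>Now each row \<open>B a\<close> stops growing modulo \<open>J\<close> at some
      \<open>q a\<close>.\<close>
    then have "\<forall>a. \<exists>b. \<forall>c>b. B a c - B a b \<in> J" by (auto simp: J_plus_def)
    then obtain q where q: "\<And>a c. q a < c \<Longrightarrow> B a c - B a (q a) \<in> J" by metis
    obtain n where n: "\<And>a::'t. a < n a" using no_greatest[OF T] by metis
    \<comment> \<open>The maximum with \<open>n a\<close> puts \<open>p a\<close> strictly above
      \<open>a\<close>, so that \<open>pos\<close> applies to \<open>B a (p a)\<close>.\<close>
    define p where "p a = max (q a) (n a)" for a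
    have p: "a < p a" for a using n unfolding p_def by (auto simp: less_max_iff_disj)
    have stable: "B a c - B a (p a) \<in> J" for a c
    proof (cases "p a < c")
      case True
      have "B a c - B a (q a) \<in> J" by (rule q) (use True in \<open>simp add: p_def\<close>)
      moreover have "B a (q a) - B a (p a) \<in> J"
        by (rule ideal_bounded[OF id mono]) (simp add: p_def)
      ultimately have "(B a c - B a (q a)) \<union> (B a (q a) - B a (p a)) \<in> J" by (rule ideal_Un[OF id])
      then show ?thesis by (rule ideal_subset[OF id]) blast
    next
      case False
      then show ?thesis using ideal_bounded[OF id mono] by simp
    qed
    define S where "S a = B a (p a)" for a
    have dec: "S b - S a \<in> J" if "a \<le> b" for a b
    proof -
      \<comment> \<open>The detour through \<open>B a (p b)\<close> first changes the row, at the
        cost of a bounded set, and then uses the stability of row \<open>a\<close>.\<close>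
      have "(B b (p b) - B a (p b)) \<union> (B a (p b) - B a (p a)) \<in> J"
        by (rule ideal_Un[OF id ideal_bounded[OF id anti[OF that]] stable])
      then show ?thesis unfolding S_def by (rule ideal_subset[OF id]) blast
    qed
    show ?thesis
    proof (cases "\<forall>a. \<exists>b>a. S a - S b \<in> J_plus J")
      case True
      then have "\<And>a. \<exists>b>a. S a - S b \<in> J_plus J" by blast
      from descending_tower_if_unstable[OF id T dec this] show ?thesis by blast
    next
      case False
      then obtain m where m: "\<And>b. m < b \<Longrightarrow> S m - S b \<in> J" by (auto simp: J_plus_def)
      \<comment> \<open>As \<open>p (c a) \<le> c b\<close> for \<open>a < b\<close>, any two of the
        intervals from \<open>f (c a)\<close> to \<open>f (p (c a))\<close> are eventually disjoint.
        Starting at \<open>n m\<close> keeps \<open>c a\<close> above \<open>m\<close>, so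
        \<open>S m\<close> lies in \<open>S (c a)\<close> modulo \<open>J\<close>.\<close>
      obtain c :: "'t \<Rightarrow> 't" where c: "\<And>a. n m \<le> c a" "\<And>a b. a < b \<Longrightarrow> p (c a) \<le> c b"
        using regular_sequence[OF T, of "n m" p] by blast
      obtain e :: "'k \<Rightarrow> 't" where e: "inj_on e {..<s}"
        using card_lt_imp_le[OF sT] unfolding card_le_inj by blast
      have "S m \<in> J"
      proof (rule no_stable_sep[OF K J E x, where W = "e ` {..<s}" and
            f = "\<lambda>a. f (c a)" and g = "\<lambda>a. f (p (c a))"])
        show "card_eq (e ` {..<s}) {..<s}"
          unfolding card_eq_def card_of_ordIso[symmetric]
          using bij_betw_inv_into[OF inj_on_imp_bij_betw[OF e]] by blast
        show "\<exists>u. \<forall>z\<ge>u. f (p (c a)) z \<le> f (c b) z" if "a < b" for a b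
          using f'[OF c(2)[OF that]] .
        show "S m - sep x (f (c a)) (f (p (c a))) \<in> J" for a
          using m[of "c a"] n[of m] c(1)[of a] unfolding S_def B_def by simp
      qed
      then show ?thesis using pos[OF p[of m]] unfolding S_def B_def J_plus_def by blast
    qed
  qed
qed

section \<open>Guessing closed sets with a single index\<close>

definition guess_set :: "'k::wellorder \<Rightarrow> ('k \<Rightarrow> 'k set set) \<Rightarrow> 'k set set \<Rightarrow> 'k set" where
  "guess_set s C D = {d \<in> acc. s \<le> d \<and> cofinal_in (C d) (P_lt s {..<d}) \<and> C d \<subseteq> D}"

lemma singleton_in_P_lt: "infinite {..<s} \<Longrightarrow> z \<in> X \<Longrightarrow> {z} \<in> P_lt s X"
  unfolding P_lt_def by (auto intro: finite_card_lt)

text \<open>On singletons the chosen function is \<open>f\<close>; on other finite sets it takes an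
  unspecified value, which can only leave fewer closed sets, and an inclusion is all that is
  asked.\<close>

lemma gen_club_closed:
  "gen_club s UNIV {y \<in> P_lt s UNIV. \<forall>z\<in>y. f z \<in> y}"
  unfolding gen_club_def
proof (intro exI[of _ "\<lambda>y. f (THE z. y = {z})"] conjI subsetI)
  fix y assume y: "y \<in> {x \<in> P_lt s UNIV. \<forall>y. finite y \<and> y \<subseteq> x \<longrightarrow> f (THE z. y = {z}) \<in> x}"
  have "f z \<in> y" if "z \<in> y" for z
  proof -
    have "finite {z} \<and> {z} \<subseteq> y" using that by simp
    then have "f (THE v. {z} = {v}) \<in> y" using y by blast
    then show ?thesis by simp
  qed
  then show "y \<in> {y \<in> P_lt s UNIV. \<forall>z\<in>y. f z \<in> y}" using y by blast
qed simp

text \<open>Because \<open>I\<close> is smaller than \<open>'t\<close>, one index serves cofinally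
  many \<open>f a\<close>; restricting to these stages makes the sets \<open>sep\<close>
  positive.\<close>

lemma tower_if_guessing:
  fixes J :: "'k::wellorder set set" and C :: "'a \<Rightarrow> 'k \<Rightarrow> 'k set set"
  assumes K: "regular_uncountable_cardinal_type TYPE('k)" and J: "kappa_complete J"
    and E: "E_gt s \<in> J_star J" and inf: "infinite {..<s}"
    and T: "regular_infinite_cardinal_type TYPE('t::wellorder)" and sT: "card_lt {..<s} (UNIV::'t set)"
    and depth: "below_depth TYPE('t) TYPE('k)"
    and I: "card_lt I (UNIV::'t set)"
    and guess: "\<And>D. D \<subseteq> P_lt s UNIV \<Longrightarrow> gen_club s UNIV D \<Longrightarrow> \<exists>i\<in>I. guess_set s (C i) D \<in> J_plus J"
  shows "(\<exists>A :: 't \<Rightarrow> 'k set. ascending_tower J I_kappa A)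
       \<or> (\<exists>A :: 't \<Rightarrow> 'k set. descending_tower J J A)"
proof -
  have reg: "regular_type TYPE('k)" using K unfolding regular_uncountable_cardinal_type_def by blast
  have regT: "regular_type TYPE('t)" using T unfolding regular_infinite_cardinal_type_def by blast
  have id: "is_ideal J" using J unfolding kappa_complete_def by blast
  have "\<exists>f :: 't \<Rightarrow> 'k \<Rightarrow> 'k. \<forall>a\<in>UNIV. \<forall>b\<in>UNIV. a < b \<longrightarrow> less_star (f a) (f b)"
    using depth[unfolded below_depth_def, rule_format, of UNIV] by simp
  then obtain f :: "'t \<Rightarrow> 'k \<Rightarrow> 'k" where f_less: "\<forall>a b. a < b \<longrightarrow> less_star (f a) (f b)"
    by auto
  have f: "\<exists>u. \<forall>z\<ge>u. f a z < f b z" if "a < b" for a b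
    by (rule less_star_tail[OF reg f_less[rule_format, OF that]])
  define D where "D a = {y \<in> P_lt s UNIV. \<forall>z\<in>y. f a z \<in> y}" for a
  have "\<exists>i\<in>I. guess_set s (C i) (D a) \<in> J_plus J" for a
    unfolding D_def by (rule guess) (auto simp: gen_club_closed)
  then obtain h where h: "\<And>a. h a \<in> I" "\<And>a. guess_set s (C (h a)) (D a) \<in> J_plus J" by metis
  obtain i where i: "\<And>a. \<exists>b\<ge>a. h b = i" using regular_pigeonhole[OF regT I, of h] h(1) by blast
  then obtain v where v: "\<And>a. a \<le> v a" "\<And>a. h (v a) = i" by metis
  obtain n where n: "\<And>a::'t. a < n a" using no_greatest[OF T] by metis
  obtain q :: "'t \<Rightarrow> 't" where q: "\<And>a b. a < b \<Longrightarrow> n (v (q a)) \<le> q b"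
    using regular_sequence[OF T, of undefined "\<lambda>a. n (v a)"] by blast
  \<comment> \<open>\<open>c\<close> climbs strictly through stages with index \<open>i\<close>;
    strictness comes from \<open>n\<close>.\<close>
  define c where "c a = v (q a)" for a
  have c: "c a < c b" if "a < b" for a b
    using n[of "v (q a)"] q[OF that] v(1)[of "q b"] unfolding c_def by simp
  have hc: "h (c a) = i" for a unfolding c_def by (rule v)
  \<comment> \<open>The default \<open>{}\<close> keeps \<open>x d z\<close> small even where no
    suitable member of \<open>C i d\<close> exists.\<close>
  define x where "x d z = (if \<exists>y\<in>C i d. z \<in> y \<and> y \<in> P_lt s {..<d}
      then SOME y. y \<in> C i d \<and> z \<in> y \<and> y \<in> P_lt s {..<d} else {})" for d z
  have x: "x d z \<in> C i d \<and> z \<in> x d z \<and> x d z \<in> P_lt s {..<d}"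
    if "\<exists>y\<in>C i d. z \<in> y \<and> y \<in> P_lt s {..<d}" for d z
    using that someI_ex[of "\<lambda>y. y \<in> C i d \<and> z \<in> y \<and> y \<in> P_lt s {..<d}"] unfolding x_def by auto
  have small: "card_lt (x d z) {..<s}" for d z
  proof (cases "\<exists>y\<in>C i d. z \<in> y \<and> y \<in> P_lt s {..<d}")
    case True
    then show ?thesis using x unfolding P_lt_def by blast
  next
    case False
    then have "x d z = {}" by (simp only: x_def if_False)
    then show ?thesis by (simp add: finite_card_lt[OF inf])
  qed
  have pos: "sep x (f (c a)) (f (c b)) \<in> J_plus J" if ab: "a < b" for a b
  proof -
    obtain u where u: "\<And>z. u \<le> z \<Longrightarrow> f (c a) z < f (c b) z" using f[OF c[OF ab]] by blast
    have "guess_set s (C i) (D (c a)) - {..u} \<in> J_plus J"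
      using pos_Diff[OF id h(2)[of "c a"] ideal_bounded[OF id atMost_in_I_kappa[OF K]]]
      unfolding hc .
    moreover have "guess_set s (C i) (D (c a)) - {..u} \<subseteq> sep x (f (c a)) (f (c b))"
    proof
      fix d assume d: "d \<in> guess_set s (C i) (D (c a)) - {..u}"
      have "\<exists>w\<in>x d z. f (c a) z \<le> w \<and> w < f (c b) z" if z: "u \<le> z" "z < d" for z
      proof -
        have "{z} \<in> P_lt s {..<d}" using singleton_in_P_lt[OF inf] z(2) by blast
        moreover have cof: "cofinal_in (C i d) (P_lt s {..<d})" and CD: "C i d \<subseteq> D (c a)"
          using d unfolding guess_set_def by auto
        ultimately have "\<exists>y\<in>C i d. z \<in> y \<and> y \<in> P_lt s {..<d}"
          unfolding cofinal_in_def by blast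
        from x[OF this] have "x d z \<in> D (c a)" "z \<in> x d z" using CD by auto
        \<comment> \<open>The left endpoint of the interval is itself the required witness, by
          closure of \<open>x d z\<close> under \<open>f (c a)\<close>.\<close>
        then have "f (c a) z \<in> x d z" unfolding D_def by blast
        then show ?thesis using u[OF z(1)] by blast
      qed
      moreover have "u < d" using d by auto
      ultimately show "d \<in> sep x (f (c a)) (f (c b))" unfolding sep_def by blast
    qed
    ultimately show ?thesis by (rule pos_superset[OF id])
  qed
  have "\<exists>u. \<forall>z\<ge>u. f (c a) z \<le> f (c b) z" if "a < b" for a b
    using f[OF c[OF that]] less_imp_le by blast
  from tower_if_sep_positive[OF K J E small T sT this pos] show ?thesis .
qed

lemma normal_diag_union: "normal_ideal J \<Longrightarrow> (\<And>a. A a \<in> J) \<Longrightarrow> diag_union A \<in> J"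
  unfolding normal_ideal_def by simp

text \<open>The positive set given by \<open>curlywedge_minus\<close> is covered by a diagonal union
  over \<open>i < d\<close>, so normality makes one term positive. The cut to \<open>{i<..}\<close>
  records where index \<open>i\<close> is meaningful.\<close>

lemma normal_guessing:
  assumes J: "normal_ideal J" and cw: "curlywedge_minus s J"
  shows "\<exists>C. (\<forall>i d. d \<in> acc \<and> s \<le> d \<and> i < d \<longrightarrow> cofinal_in (C i d) (P_lt s {..<d})) \<and>
    (\<forall>D. D \<subseteq> P_lt s UNIV \<and> gen_club s UNIV D \<longrightarrow>
      (\<exists>i. guess_set s (C i) D \<inter> {i<..} \<in> J_plus J))"
proof -
  obtain C :: "'a \<Rightarrow> 'a \<Rightarrow> 'a set set" where
    C: "\<forall>d \<in> acc. s \<le> d \<longrightarrow> (\<forall>i<d. cofinal_in (C d i) (P_lt s {..<d}))" and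
    g: "\<forall>D. D \<subseteq> P_lt s UNIV \<and> gen_club s UNIV D \<longrightarrow>
      {d \<in> acc. s \<le> d \<and> (\<exists>i<d. C d i \<subseteq> D)} \<in> J_plus J"
    using cw unfolding curlywedge_minus_def by (elim exE conjE)
  have id: "is_ideal J" using J unfolding normal_ideal_def kappa_complete_def by blast
  show ?thesis
  proof (intro exI[of _ "\<lambda>i d. C d i"] conjI allI impI; (elim conjE)?)
    show "\<exists>i. guess_set s (\<lambda>d. C d i) D \<inter> {i<..} \<in> J_plus J"
      if D: "D \<subseteq> P_lt s UNIV" "gen_club s UNIV D" for D
    proof (rule ccontr)
      assume "\<not> ?thesis"
      then have "diag_union (\<lambda>i. guess_set s (\<lambda>d. C d i) D \<inter> {i<..}) \<in> J"
        by (intro normal_diag_union[OF J]) (simp add: J_plus_def)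
      moreover have "{d \<in> acc. s \<le> d \<and> (\<exists>i<d. C d i \<subseteq> D)}
          \<subseteq> diag_union (\<lambda>i. guess_set s (\<lambda>d. C d i) D \<inter> {i<..})"
        using C unfolding diag_union_def guess_set_def by blast
      ultimately show False using g[rule_format, OF conjI[OF D]] ideal_subset[OF id] unfolding J_plus_def by blast
    qed
  qed (use C in blast)
qed

text \<open>Injections \<open>e d\<close> of \<open>d\<close> into \<open>nu\<close> replace the
  indices \<open>i < d\<close> by indices below \<open>nu\<close>, so an ordinary union of
  \<open>nu\<close> many sets suffices and completeness can act in place of normality.\<close>

lemma successor_guessing:
  fixes J :: "'k::wellorder set set"
  assumes nu: "kappa_successor_of (nu::'k)" and nuK: "card_lt {..<nu} (UNIV::'k set)"
    and J: "kappa_complete J" and cw: "curlywedge_minus s J"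
  shows "\<exists>C. \<forall>D. D \<subseteq> P_lt s UNIV \<and> gen_club s UNIV D \<longrightarrow>
      (\<exists>i\<in>{..<nu}. guess_set s (C i) D \<in> J_plus J)"
proof -
  obtain C :: "'k \<Rightarrow> 'k \<Rightarrow> 'k set set" where
    C: "\<forall>d \<in> acc. s \<le> d \<longrightarrow> (\<forall>i<d. cofinal_in (C d i) (P_lt s {..<d}))" and
    g: "\<forall>D. D \<subseteq> P_lt s UNIV \<and> gen_club s UNIV D \<longrightarrow>
      {d \<in> acc. s \<le> d \<and> (\<exists>i<d. C d i \<subseteq> D)} \<in> J_plus J"
    using cw unfolding curlywedge_minus_def by (elim exE conjE)
  have id: "is_ideal J" using J unfolding kappa_complete_def by blast
  obtain e :: "'k \<Rightarrow> 'k \<Rightarrow> 'k" where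
    e: "\<And>d. inj_on (e d) {..<d}" "\<And>d. e d ` {..<d} \<subseteq> {..<nu}"
    using nu unfolding kappa_successor_of_def card_le_inj by metis
  \<comment> \<open>Where \<open>j\<close> is not a value of \<open>e d\<close> the index is
    unspecified; the cofinality clause of \<open>guess_set\<close> discards \<open>d\<close> if the
    resulting family is not cofinal.\<close>
  let ?C = "\<lambda>j d. C d (inv_into {..<d} (e d) j)"
  show ?thesis
  proof (intro exI[of _ ?C] allI impI, elim conjE, rule ccontr)
    fix D assume D: "D \<subseteq> P_lt s UNIV" "gen_club s UNIV D"
      and "\<not> (\<exists>j\<in>{..<nu}. guess_set s (?C j) D \<in> J_plus J)"
    then have "(\<Union>j\<in>{..<nu}. guess_set s (?C j) D) \<in> J"
      by (intro complete_UN[OF J nuK]) (auto simp: J_plus_def)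
    moreover have "{d \<in> acc. s \<le> d \<and> (\<exists>i<d. C d i \<subseteq> D)} \<subseteq> (\<Union>j\<in>{..<nu}. guess_set s (?C j) D)"
    proof
      fix d assume "d \<in> {d \<in> acc. s \<le> d \<and> (\<exists>i<d. C d i \<subseteq> D)}"
      then obtain i where i: "d \<in> acc" "s \<le> d" "i < d" "C d i \<subseteq> D" by blast
      have "?C (e d i) d = C d i" using inv_into_f_f[OF e(1)] i(3) by simp
      moreover have "e d i < nu" using e(2)[of d] i(3) by auto
      ultimately show "d \<in> (\<Union>j\<in>{..<nu}. guess_set s (?C j) D)"
        using i C unfolding guess_set_def by fastforce
    qed
    ultimately show False using g[rule_format, OF conjI[OF D]] ideal_subset[OF id] unfolding J_plus_def by blast
  qed
qed

section \<open>Families of \<open>\<kappa>\<close> many disjoint positive sets\<close>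

lemma successor_disjoint_positive:
  fixes J :: "'k::wellorder set set"
  assumes K: "regular_uncountable_cardinal_type TYPE('k)"
    and nu: "kappa_successor_of (nu::'k)" and J: "kappa_complete J"
  obtains P and W :: "'k set" where "card_eq W (UNIV::'k set)" and "\<And>w. w \<in> W \<Longrightarrow> P w \<in> J_plus J"
    and "\<And>v w. v \<in> W \<Longrightarrow> w \<in> W \<Longrightarrow> v \<noteq> w \<Longrightarrow> P v \<inter> P w = {}"
proof -
  have reg: "regular_type TYPE('k)" and nuK: "card_lt {..<nu} (UNIV::'k set)"
    using K unfolding regular_uncountable_cardinal_type_def by auto
  have id: "is_ideal J" using J unfolding kappa_complete_def by blast
  obtain e :: "'k \<Rightarrow> 'k \<Rightarrow> 'k" where
    e: "\<And>d. inj_on (e d) {..<d}" "\<And>d. e d ` {..<d} \<subseteq> {..<nu}"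
    using nu unfolding kappa_successor_of_def card_le_inj by metis
  \<comment> \<open>This is an Ulam matrix: row \<open>w\<close> covers every \<open>d > w\<close>,
    so it has a positive entry, and each column is disjoint because \<open>e d\<close> is
    injective.\<close>
  define U where "U w i = {d. w < d \<and> e d w = i}" for w i
  have "\<exists>i\<in>{..<nu}. U w i \<in> J_plus J" for w
  proof (rule ccontr)
    assume "\<not> ?thesis"
    then have "(\<Union>i\<in>{..<nu}. U w i) \<in> J"
      by (intro complete_UN[OF J nuK]) (auto simp: J_plus_def)
    then have "(\<Union>i\<in>{..<nu}. U w i) \<union> {..w} \<in> J"
      by (intro ideal_Un[OF id] ideal_bounded[OF id atMost_in_I_kappa[OF K]])
    moreover have "d \<in> (\<Union>i\<in>{..<nu}. U w i) \<union> {..w}" for d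
      using e(2)[of d] unfolding U_def by force
    then have "(\<Union>i\<in>{..<nu}. U w i) \<union> {..w} = UNIV" by blast
    ultimately show False using id unfolding is_ideal_def by simp
  qed
  then obtain h where h: "\<And>w. h w \<in> {..<nu}" "\<And>w. U w (h w) \<in> J_plus J" by metis
  \<comment> \<open>Some column has positive entries in unboundedly many rows, hence in
    \<open>\<kappa>\<close> many by regularity.\<close>
  have "\<exists>i\<in>{..<nu}. \<forall>a. \<exists>b\<ge>a. h b = i" by (rule regular_pigeonhole[OF reg nuK h(1)])
  then obtain i where i: "\<forall>a. \<exists>b\<ge>a. h b = i" by blast
  show thesis
  proof (rule that[of "{w. h w = i}" "\<lambda>w. U w i"])
    show "card_eq {w. h w = i} (UNIV::'k set)"
      using reg[unfolded regular_type_def, rule_format, of "{w. h w = i}"] i by auto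
    show "U v i \<inter> U w i = {}" if "v \<noteq> w" for v w
    proof -
      have False if d: "d \<in> U v i" "d \<in> U w i" for d
        using inj_onD[OF e(1), of d v w] d \<open>v \<noteq> w\<close> unfolding U_def by auto
      then show ?thesis by blast
    qed
  qed (use h(2) in auto)
qed

text \<open>A pressing-down argument: since \<open>r\<close> is regressive, the set is covered by
  the diagonal union of the fibres from \<open>g\<close> on.\<close>

lemma normal_fibre_positive:
  assumes J: "normal_ideal J" and Q: "{d. r d < d \<and> g \<le> r d \<and> d \<in> X} \<in> J_plus J"
  shows "\<exists>b\<ge>g. {d. r d = b \<and> d \<in> X} \<in> J_plus J"
proof (rule ccontr)
  assume *: "\<not> ?thesis"
  have id: "is_ideal J" using J unfolding normal_ideal_def kappa_complete_def by blast
  \<comment> \<open>Indices below \<open>g\<close> contribute the empty set.\<close>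
  define B where "B b = {d. g \<le> b \<and> r d = b \<and> d \<in> X}" for b
  have "B b \<in> J" for b
  proof (cases "g \<le> b")
    case True
    then show ?thesis using * unfolding B_def J_plus_def by auto
  next
    case False
    then have "B b = {}" unfolding B_def by auto
    then show ?thesis using ideal_bounded[OF id, of "{}"] unfolding I_kappa_def by auto
  qed
  then have "diag_union B \<in> J" by (rule normal_diag_union[OF J])
  moreover have "{d. r d < d \<and> g \<le> r d \<and> d \<in> X} \<subseteq> diag_union B"
    unfolding diag_union_def B_def by blast
  ultimately show False using Q ideal_subset[OF id] unfolding J_plus_def by blast
qed

text \<open>Fibres of one function are disjoint; a regressive function unbounded modulo
  \<open>J\<close> has positive fibres at arbitrarily large values, hence \<open>\<kappa>\<close>
  many by regularity.\<close>

lemma normal_disjoint_positive: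
  fixes J :: "'k::wellorder set set"
  assumes K: "regular_uncountable_cardinal_type TYPE('k)"
    and J: "normal_ideal J" and E: "E_gt s \<in> J_star J" and inf: "infinite {..<s}"
    and cw: "curlywedge_minus s J"
  obtains P and W :: "'k set" where "card_eq W (UNIV::'k set)" and "\<And>w. w \<in> W \<Longrightarrow> P w \<in> J_plus J"
    and "\<And>v w. v \<in> W \<Longrightarrow> w \<in> W \<Longrightarrow> v \<noteq> w \<Longrightarrow> P v \<inter> P w = {}"
proof -
  have reg: "regular_type TYPE('k)" using K unfolding regular_uncountable_cardinal_type_def by blast
  have id: "is_ideal J" using J unfolding normal_ideal_def kappa_complete_def by blast
  obtain C where
    C: "\<forall>i d. d \<in> acc \<and> s \<le> d \<and> i < d \<longrightarrow> cofinal_in (C i d) (P_lt s {..<d})" and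
    guess: "\<forall>D. D \<subseteq> P_lt s UNIV \<and> gen_club s UNIV D \<longrightarrow>
      (\<exists>i. guess_set s (C i) D \<inter> {i<..} \<in> J_plus J)"
    using normal_guessing[OF J cw] by (elim exE conjE)
  define X where "X i = {d \<in> E_gt s. s \<le> d \<and> i < d}" for i
  have *: "\<exists>y b. y \<in> C i d \<and> i \<in> y \<and> b < d \<and> y \<subseteq> {..<b}" if d: "d \<in> X i" for i d
  proof -
    have "{i} \<in> P_lt s {..<d}" using singleton_in_P_lt[OF inf] d unfolding X_def by blast
    then obtain y where y: "y \<in> C i d" "i \<in> y" "y \<in> P_lt s {..<d}"
      using C[rule_format, of d i] d unfolding X_def E_gt_def cofinal_in_def by blast
    then have "card_le y {..<s}" "\<And>w. w \<in> y \<Longrightarrow> w < d"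
      using card_lt_imp_le unfolding P_lt_def by auto
    moreover have "cf_gt d s" using d unfolding X_def E_gt_def by blast
    ultimately show ?thesis using cf_gt_family_bound[of d s y "\<lambda>w. w"] y by blast
  qed
  define x where "x i d = (SOME y. \<exists>b. y \<in> C i d \<and> i \<in> y \<and> b < d \<and> y \<subseteq> {..<b})" for i d
  have x: "\<exists>b. x i d \<in> C i d \<and> i \<in> x i d \<and> b < d \<and> x i d \<subseteq> {..<b}" if "d \<in> X i" for i d
    unfolding x_def by (rule someI_ex[OF *[OF that]])
  \<comment> \<open>The cofinality of \<open>d\<close> exceeds \<open>s\<close>, so the small set
    \<open>x i d\<close> is bounded below \<open>d\<close>; this bound is the regressive
    function.\<close>
  define r where "r i d = (SOME b. b < d \<and> x i d \<subseteq> {..<b})" for i d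
  have xr: "x i d \<in> C i d \<and> i \<in> x i d \<and> r i d < d \<and> x i d \<subseteq> {..<r i d}"
    if "d \<in> X i" for i d
    using x[OF that] someI_ex[of "\<lambda>b. b < d \<and> x i d \<subseteq> {..<b}"] unfolding r_def by blast
  text \<open>Otherwise let \<open>\<gamma> i\<close> bound \<open>r i\<close> modulo \<open>J\<close>. Whenever \<open>x i d\<close> is closed under \<open>\<gamma>\<close>, it contains
    \<open>\<gamma> i\<close>, because it contains \<open>i\<close>, and then \<open>r i d\<close> exceeds the bound.\<close>
  have "\<exists>i. \<forall>g. {d. r i d < d \<and> g \<le> r i d \<and> d \<in> X i} \<in> J_plus J"
  proof (rule ccontr)
    assume "\<not> ?thesis"
    then obtain \<gamma> where \<gamma>: "\<And>i. {d. r i d < d \<and> \<gamma> i \<le> r i d \<and> d \<in> X i} \<in> J"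
      unfolding J_plus_def by (simp del: not_all add: not_all[where 'a = 'k]) metis
    obtain i where "guess_set s (C i) {y \<in> P_lt s UNIV. \<forall>z\<in>y. \<gamma> z \<in> y} \<inter> {i<..} \<in> J_plus J"
      (is "?G \<in> _") using guess[rule_format, OF conjI[OF _ gen_club_closed[of s \<gamma>]]] by blast
    moreover have "- E_gt s \<union> {d. r i d < d \<and> \<gamma> i \<le> r i d \<and> d \<in> X i} \<in> J"
      using E \<gamma> by (intro ideal_Un[OF id]) (auto simp: J_star_def)
    moreover have "?G \<subseteq> - E_gt s \<union> {d. r i d < d \<and> \<gamma> i \<le> r i d \<and> d \<in> X i}"
    proof
      fix d assume d: "d \<in> ?G"
      show "d \<in> - E_gt s \<union> {d. r i d < d \<and> \<gamma> i \<le> r i d \<and> d \<in> X i}"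
      proof (cases "d \<in> E_gt s")
        case True
        then have X: "d \<in> X i" using d unfolding X_def guess_set_def by auto
        then have "\<gamma> i \<in> x i d" using xr[OF X] d unfolding guess_set_def by blast
        then show ?thesis using xr[OF X] X by auto
      qed simp
    qed
    ultimately show False using ideal_subset[OF id] unfolding J_plus_def by blast
  qed
  then obtain i where i: "\<And>g. {d. r i d < d \<and> g \<le> r i d \<and> d \<in> X i} \<in> J_plus J" by blast
  let ?P = "\<lambda>b. {d. r i d = b \<and> d \<in> X i}"
  show thesis
  proof (rule that[of "{b. ?P b \<in> J_plus J}" ?P])
    show "card_eq {b. ?P b \<in> J_plus J} (UNIV::'k set)"
      using reg[unfolded regular_type_def, rule_format, of "{b. ?P b \<in> J_plus J}"]
        normal_fibre_positive[OF J i] by auto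
  qed auto
qed

section \<open>Comparing the length of the tower with the number of indices\<close>

theorem theorem4p7:
  fixes J :: "'k::wellorder set set" and s :: "'k"
  assumes kappa: "regular_uncountable_cardinal_type TYPE('k)"
    and sigma_card: "is_cardinal_elem s" and sigma_unc: "uncountable_set {..<s}"
    and cases: "(\<exists>nu::'k. kappa_successor_of nu \<and> s < nu \<and> kappa_complete J)
                \<or> (weakly_inaccessible TYPE('k) \<and> normal_ideal J)"
    and E: "E_gt s \<in> J_star J"
    and cw: "curlywedge_minus s J"
    and tau: "regular_infinite_cardinal_type TYPE('t::wellorder)"
    and depth: "below_depth TYPE('t) TYPE('k)"
  shows "(\<exists>A :: 't \<Rightarrow> 'k set. ascending_tower J I_kappa A)
       \<or> (\<exists>A :: 't \<Rightarrow> 'k set. descending_tower J J A)"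
proof -
  have inf: "infinite {..<s}" by (rule uncountable_set_infinite[OF sigma_unc])
  have smallK: "card_lt {..<b} (UNIV::'k set)" for b :: 'k
    using kappa unfolding regular_uncountable_cardinal_type_def by blast
  have disjoint: ?thesis
    if "card_le (UNIV::'t set) (UNIV::'k set)" "is_ideal J" "card_eq W (UNIV::'k set)"
      "\<And>w. w \<in> W \<Longrightarrow> P w \<in> J_plus J"
      "\<And>v w. v \<in> W \<Longrightarrow> w \<in> W \<Longrightarrow> v \<noteq> w \<Longrightarrow> P v \<inter> P w = {}"
    for P and W :: "'k set"
  proof -
    have le: "card_le (UNIV::'t set) W"
      using that(1,3) ordIso_symmetric ordLeq_ordIso_trans unfolding card_le_def card_eq_def by blast
    have "\<exists>A :: 't \<Rightarrow> 'k set. ascending_tower J I_kappa A"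
      by (rule ascending_tower_if_disjoint[where P = P, OF that(2) le that(4,5)])
    then show ?thesis by blast
  qed
  from cases show ?thesis
  proof (elim disjE exE conjE)
    fix nu :: 'k
    assume nu: "kappa_successor_of nu" "s < nu" and J: "kappa_complete J"
    have id: "is_ideal J" using J unfolding kappa_complete_def by blast
    \<comment> \<open>Here the indices are the ordinals below \<open>nu\<close>, so the size of
      \<open>'t\<close> is compared with \<open>nu\<close>.\<close>
    show ?thesis
    proof (cases "card_lt {..<nu} (UNIV::'t set)")
      case True
      have sT: "card_lt {..<s} (UNIV::'t set)" by (rule card_lt_subset[OF True]) (use nu(2) in auto)
      obtain C where "\<forall>D. D \<subseteq> P_lt s UNIV \<and> gen_club s UNIV D \<longrightarrow>
          (\<exists>i\<in>{..<nu}. guess_set s (C i) D \<in> J_plus J)"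
        using successor_guessing[OF nu(1) smallK J cw] by (elim exE)
      then have "\<exists>i\<in>{..<nu}. guess_set s (C i) D \<in> J_plus J"
        if "D \<subseteq> P_lt s UNIV" "gen_club s UNIV D" for D
        using that by simp
      from tower_if_guessing[OF kappa J E inf tau sT depth True this] show ?thesis .
    next
      case False
      then have "card_le (UNIV::'t set) {..<nu}" using card_lt_or_le by blast
      then have le: "card_le (UNIV::'t set) (UNIV::'k set)"
        by (rule card_lt_imp_le[OF card_le_lt_trans[OF _ smallK]])
      show ?thesis
        by (rule successor_disjoint_positive[OF kappa nu(1) J], rule disjoint[OF le id]) auto
    qed
  next
    assume J: "normal_ideal J"
    then have Jc: "kappa_complete J" and id: "is_ideal J"
      unfolding normal_ideal_def kappa_complete_def by auto
    \<comment> \<open>Here the indices range over all of \<open>'k\<close>, so the size of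
      \<open>'t\<close> is compared with \<open>\<kappa>\<close> itself.\<close>
    show ?thesis
    proof (cases "card_lt (UNIV::'k set) (UNIV::'t set)")
      case True
      have sT: "card_lt {..<s} (UNIV::'t set)" by (rule card_lt_subset[OF True]) simp
      obtain C where C: "\<forall>D. D \<subseteq> P_lt s UNIV \<and> gen_club s UNIV D \<longrightarrow>
          (\<exists>i. guess_set s (C i) D \<inter> {i<..} \<in> J_plus J)"
        using normal_guessing[OF J cw] by (elim exE conjE)
      have "\<exists>i\<in>UNIV. guess_set s (C i) D \<in> J_plus J"
        if D: "D \<subseteq> P_lt s UNIV" "gen_club s UNIV D" for D
        using C[rule_format, OF conjI[OF D]] pos_superset[OF id] by blast
      from tower_if_guessing[OF kappa Jc E inf tau sT depth True this] show ?thesis .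
    next
      case False
      then have le: "card_le (UNIV::'t set) (UNIV::'k set)" using card_lt_or_le by blast
      show ?thesis
        by (rule normal_disjoint_positive[OF kappa J E inf cw], rule disjoint[OF le id]) auto
    qed
  qed
qed

end
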